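(* Consider the chain of $N+1$ particles, i.e. $G=\{0,\dots,N\}$ with $i\sim j$ if and only if $|i-j|\le 1$, and all interaction potentials equal to a single potential $W$ with strong convexity constant $\lambda>0$. Let $\rho_D$ be the Dirichlet eigenvalue of the associated discrete Laplacian $L_G$. Then $$\rho_D\ \ge\ \lambda\left(1-\cos\left(\frac{\pi}{2N}\right)\right).$$
   Context: $W\in\mathcal C^\infty(\mathbb R^d)$ is even with $y^T\nabla^2W(x)y\ge\lambda|y|^2$ for all $x,y$. The discrete Laplacian is $L_Gh(i)=\sum_{j\sim i}\lambda\,(h(j)-h(i))$, seen as an $(N+1)\times(N+1)$ matrix, and $$\rho_D=\inf_{h\in\mathbb R^{N+1}\setminus\{0\},\ h_0=0}\frac{-h^TL_Gh}{|h|^2}.$$ *)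

theory Defs
  imports "HOL-Analysis.Analysis" "Jordan_Normal_Form.Matrix"
begin

(* Both Jordan_Normal_Form and HOL-Analysis use the infix symbol $; we keep
   the former's (real vec, with dimension a natural number) for the space of
   functions on the graph, and use real^'d only for the space in which W lives. *)
no_notation Finite_Cartesian_Product.vec_nth (infixl \<open>$\<close> 90)

definition partial_deriv :: "'d::finite \<Rightarrow> (real^'d \<Rightarrow> real) \<Rightarrow> real^'d \<Rightarrow> real" where
  "partial_deriv i f x = frechet_derivative f (at x) (axis i 1)"

primrec C_k :: "nat \<Rightarrow> (real^'d::finite \<Rightarrow> real) \<Rightarrow> bool" where
  "C_k 0 f \<longleftrightarrow> continuous_on UNIV f"
| "C_k (Suc k) f \<longleftrightarrow> (\<forall>x. f differentiable (at x)) \<and> (\<forall>i. C_k k (partial_deriv i f))"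

definition smooth :: "(real^'d::finite \<Rightarrow> real) \<Rightarrow> bool" where
  "smooth f \<longleftrightarrow> (\<forall>k. C_k k f)"

definition hessian :: "(real^'d::finite \<Rightarrow> real) \<Rightarrow> real^'d \<Rightarrow> real^'d^'d" where
  "hessian f x = (\<chi> i j. partial_deriv i (partial_deriv j f) x)"

definition strongly_convex :: "(real^'d::finite \<Rightarrow> real) \<Rightarrow> real \<Rightarrow> bool" where
  "strongly_convex f lam \<longleftrightarrow> (\<forall>x y. inner y (hessian f x *v y) \<ge> lam * (norm y)\<^sup>2)"

(* Graphs have vertex set {0..<n}, adjacency relation adj, and the same
   constant lam on every edge.  A loop contributes 0 to the sum. *)
definition laplacian :: "nat \<Rightarrow> (nat \<Rightarrow> nat \<Rightarrow> bool) \<Rightarrow> real \<Rightarrow> real vec \<Rightarrow> nat \<Rightarrow> real" where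
  "laplacian n adj lam h i = (\<Sum>j | j < n \<and> adj i j. lam * (h $ j - h $ i))"

definition laplacian_mat :: "nat \<Rightarrow> (nat \<Rightarrow> nat \<Rightarrow> bool) \<Rightarrow> real \<Rightarrow> real mat" where
  "laplacian_mat n adj lam = mat n n (\<lambda>(i, j). laplacian n adj lam (unit_vec n j) i)"

lemma laplacian_mat_mult:
  assumes h: "h \<in> carrier_vec n" and i: "i < n"
  shows "(laplacian_mat n adj lam *\<^sub>v h) $ i = laplacian n adj lam h i"
proof -
  have unit: "(\<Sum>j = 0..<n. unit_vec n j $ k * h $ j) = h $ k" if "k < n" for k
  proof -
    have "(\<Sum>j = 0..<n. unit_vec n j $ k * h $ j) = (\<Sum>j = 0..<n. if j = k then h $ j else 0)"
      using that by (intro sum.cong) auto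
    also have "\<dots> = h $ k" using that by simp
    finally show ?thesis .
  qed
  have "(laplacian_mat n adj lam *\<^sub>v h) $ i
      = (\<Sum>j = 0..<n. \<Sum>k | k < n \<and> adj i k.
           lam * (unit_vec n j $ k * h $ j - unit_vec n j $ i * h $ j))"
    using h i
    by (auto simp: laplacian_mat_def laplacian_def scalar_prod_def sum_distrib_right
        left_diff_distrib mult.assoc intro!: sum.cong simp del: index_unit_vec)
  also have "\<dots> = (\<Sum>k | k < n \<and> adj i k. \<Sum>j = 0..<n.
           lam * (unit_vec n j $ k * h $ j - unit_vec n j $ i * h $ j))"
    by (rule sum.swap)
  also have "\<dots> = (\<Sum>k | k < n \<and> adj i k. lam * (h $ k - h $ i))"
    using i by (intro sum.cong) (auto simp: sum_distrib_left[symmetric] sum_subtractf unit simp del: index_unit_vec)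
  finally show ?thesis by (simp add: laplacian_def)
qed

definition dirichlet_eigenvalue :: "nat \<Rightarrow> (nat \<Rightarrow> nat \<Rightarrow> bool) \<Rightarrow> real \<Rightarrow> real" where
  "dirichlet_eigenvalue n adj lam =
     Inf {- scalar_prod h (laplacian_mat n adj lam *\<^sub>v h) / scalar_prod h h | h.
            h \<in> carrier_vec n \<and> h \<noteq> 0\<^sub>v n \<and> h $ 0 = 0}"

definition chain_adj :: "nat \<Rightarrow> nat \<Rightarrow> bool" where
  "chain_adj i j \<longleftrightarrow> \<bar>int i - int j\<bar> \<le> 1"

end

(* The function phi i = sin (i b) with b = pi / (2 N) is positive on {1..N}, vanishes at 0 and satisfies
   (- Laplacian phi) i = 2 (1 - cos b) phi i for 0 < i < N, but only (1 - cos b) phi N at the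
   free end N, because phi N = 1 and phi (N - 1) = cos b.  As a positive supersolution for the
   value 1 - cos b it bounds the Dirichlet form from below (a discrete Picone inequality):
   (h (i+1) - h i)^2 >= h (i+1)^2 (1 - phi i / phi (i+1)) + h i^2 (1 - phi (i+1) / phi i). *)
theory Submission
  imports Defs
begin

lemma sum_Collect_less_Suc:
  fixes f :: "nat \<Rightarrow> 'a::comm_monoid_add"
  shows "(\<Sum>j | j < Suc n \<and> P j. f j) = (\<Sum>j | j < n \<and> P j. f j) + (if P n then f n else 0)"
proof -
  have "{j. j < Suc n \<and> P j} = (if P n then insert n {j. j < n \<and> P j} else {j. j < n \<and> P j})"
    by (auto simp: less_Suc_eq)
  then show ?thesis by (simp add: add.commute)
qed

text \<open>Summation by parts: each edge is counted from both ends, and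
  \<open>h i * (h i - h j) + h j * (h j - h i)\<close> is a square. The induction attaches one
  vertex, hence one edge, at a time.\<close>

lemma chain_dirichlet_form:
  fixes h :: "nat \<Rightarrow> real"
  shows "(\<Sum>i<Suc n. \<Sum>j | j < Suc n \<and> chain_adj i j. h i * (h i - h j))
       = (\<Sum>i<n. (h (Suc i) - h i)\<^sup>2)"
proof (induction n)
  case 0
  show ?case by (simp add: sum_Collect_less_Suc)
next
  case (Suc n)
  have right: "(\<Sum>i<Suc n. if chain_adj i (Suc n) then h i * (h i - h (Suc n)) else 0)
      = h n * (h n - h (Suc n))"
  proof -
    have "(\<Sum>i<Suc n. if chain_adj i (Suc n) then h i * (h i - h (Suc n)) else 0)
        = (\<Sum>i<Suc n. if i = n then h n * (h n - h (Suc n)) else 0)"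
      by (rule sum.cong) (auto simp: chain_adj_def)
    then show ?thesis by simp
  qed
  have left: "(\<Sum>j | j < Suc n \<and> chain_adj (Suc n) j. h (Suc n) * (h (Suc n) - h j))
      = h (Suc n) * (h (Suc n) - h n)"
  proof -
    have "{j. j < Suc n \<and> chain_adj (Suc n) j} = {n}"
      by (auto simp: chain_adj_def)
    then show ?thesis by simp
  qed
  \<comment> \<open>Attaching vertex \<open>Suc n\<close> adds one column and one row. Their common
    entry is the loop at \<open>Suc n\<close>, whose term is zero.\<close>
  have "(\<Sum>i<Suc (Suc n). \<Sum>j | j < Suc (Suc n) \<and> chain_adj i j. h i * (h i - h j))
      = (\<Sum>i<Suc n. \<Sum>j | j < Suc n \<and> chain_adj i j. h i * (h i - h j))
        + (\<Sum>i<Suc n. if chain_adj i (Suc n) then h i * (h i - h (Suc n)) else 0)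
        + (\<Sum>j | j < Suc n \<and> chain_adj (Suc n) j. h (Suc n) * (h (Suc n) - h j))"
    unfolding sum.lessThan_Suc[of _ "Suc n"] sum_Collect_less_Suc[where n = "Suc n"] sum.distrib
    by simp
  also have "\<dots> = (\<Sum>i<Suc n. (h (Suc i) - h i)\<^sup>2)"
    unfolding Suc.IH right left by (simp add: power2_eq_square algebra_simps)
  finally show ?case .
qed

lemma laplacian_mat_chain_quadratic_form:
  assumes h: "h \<in> carrier_vec (Suc N)"
  shows "- scalar_prod h (laplacian_mat (Suc N) chain_adj lam *\<^sub>v h)
       = lam * (\<Sum>i<N. (h $ Suc i - h $ i)\<^sup>2)"
proof -
  have dim: "dim_vec (laplacian_mat (Suc N) chain_adj lam *\<^sub>v h) = Suc N"
    by (simp add: laplacian_mat_def)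
  have "- scalar_prod h (laplacian_mat (Suc N) chain_adj lam *\<^sub>v h)
      = - (\<Sum>i<Suc N. h $ i * laplacian (Suc N) chain_adj lam h i)"
    unfolding scalar_prod_def dim atLeast0LessThan
    by (simp add: laplacian_mat_mult[OF h] del: sum.lessThan_Suc index_mult_mat_vec)
  also have "\<dots> = lam * (\<Sum>i<Suc N. \<Sum>j | j < Suc N \<and> chain_adj i j. h $ i * (h $ i - h $ j))"
    unfolding laplacian_def sum_distrib_left sum_negf[symmetric]
    by (intro sum.cong refl) (simp add: algebra_simps)
  also have "\<dots> = lam * (\<Sum>i<N. (h $ Suc i - h $ i)\<^sup>2)"
    by (simp only: chain_dirichlet_form)
  finally show ?thesis .
qed

text \<open>The gap between the two sides is \<open>(q * x - p * y)\<^sup>2 / (p * q)\<close>, which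
  vanishes exactly when \<open>(x, y)\<close> is proportional to \<open>(p, q)\<close>.\<close>

lemma picone_edge:
  fixes x y p q :: real
  assumes "p > 0" "q > 0"
  shows "x\<^sup>2 * (1 - q / p) + y\<^sup>2 * (1 - p / q) \<le> (y - x)\<^sup>2"
proof -
  have "(y - x)\<^sup>2 - (x\<^sup>2 * (1 - q / p) + y\<^sup>2 * (1 - p / q)) = (q * x - p * y)\<^sup>2 / (p * q)"
    using assms by (simp add: field_simps power2_eq_square)
  moreover have "\<dots> \<ge> 0" using assms by simp
  ultimately show ?thesis by linarith
qed

text \<open>Sums the Picone inequality along the chain. Each vertex from 1 to \<open>n\<close>
  collects total weight \<open>mu\<close> from its two edges; vertex \<open>Suc n\<close> has so far
  met only its left edge, which leaves the boundary term.\<close>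

lemma dirichlet_form_lower_bound:
  fixes h phi :: "nat \<Rightarrow> real"
  assumes pos: "\<And>i. 0 < i \<Longrightarrow> i \<le> N \<Longrightarrow> phi i > 0"
    and phi0: "phi 0 = 0" and h0: "h 0 = 0"
    and eigen: "\<And>i. phi i + phi (Suc (Suc i)) = (2 - mu) * phi (Suc i)"
    and "n < N"
  shows "mu * (\<Sum>i\<le>n. (h i)\<^sup>2) + (h (Suc n))\<^sup>2 * (1 - phi n / phi (Suc n))
       \<le> (\<Sum>i<Suc n. (h (Suc i) - h i)\<^sup>2)"
  using \<open>n < N\<close>
proof (induction n)
  case 0
  \<comment> \<open>Picone does not apply to the first edge, since \<open>phi 0 = 0\<close>; there
    both sides equal \<open>(h 1)\<^sup>2\<close>.\<close>
  show ?case by (simp add: h0 phi0)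
next
  case (Suc n)
  let ?p = "phi (Suc n)" and ?q = "phi (Suc (Suc n))"
  have p: "?p > 0" and q: "?q > 0" using pos Suc.prems by auto
  \<comment> \<open>Dividing \<open>eigen\<close> by \<open>?p\<close> shows that the weights from
    the left and right edges at \<open>Suc n\<close> add up to \<open>mu\<close>.\<close>
  have ratio: "1 - phi n / ?p = mu - (1 - ?q / ?p)"
    using eigen[of n] p by (simp add: field_simps)
  have "(h (Suc n))\<^sup>2 * (1 - phi n / ?p)
      = mu * (h (Suc n))\<^sup>2 - (h (Suc n))\<^sup>2 * (1 - ?q / ?p)"
    unfolding ratio by (simp add: algebra_simps)
  with picone_edge[OF p q, of "h (Suc n)" "h (Suc (Suc n))"] Suc.IH Suc.prems
  show ?case by (simp add: distrib_left)
qed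

text \<open>The chain carries a quarter period of the sine, so \<open>phi\<close> increases from 0
  to 1 and stays positive after vertex 0.\<close>

lemma chain_poincare:
  fixes h :: "nat \<Rightarrow> real"
  assumes "N \<ge> 1" and h0: "h 0 = 0"
  shows "(1 - cos (pi / (2 * real N))) * (\<Sum>i\<le>N. (h i)\<^sup>2) \<le> (\<Sum>i<N. (h (Suc i) - h i)\<^sup>2)"
proof -
  define b where "b = pi / (2 * real N)"
  define phi where "phi i = sin (real i * b)" for i
  have Nb: "real N * b = pi / 2" using assms(1) by (simp add: b_def)
  have b: "b > 0" using assms(1) by (simp add: b_def)
  obtain m where N: "N = Suc m" using assms(1) by (cases N) auto
  have pos: "phi i > 0" if "0 < i" "i \<le> N" for i
  proof -
    have "real i * b \<le> pi / 2"
      unfolding Nb[symmetric] using that b by (intro mult_right_mono) auto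
    then have "real i * b < pi" using pi_gt_zero by linarith
    then show ?thesis unfolding phi_def using that b by (intro sin_gt_zero) auto
  qed
  have eigen: "phi i + phi (Suc (Suc i)) = (2 - 2 * (1 - cos b)) * phi (Suc i)" for i
  proof -
    have "real i * b = real (Suc i) * b - b" "real (Suc (Suc i)) * b = real (Suc i) * b + b"
      by (simp_all add: algebra_simps)
    then show ?thesis unfolding phi_def by (simp only: sin_add sin_diff) (simp add: algebra_simps)
  qed
  have "phi N = 1" by (simp only: phi_def Nb sin_pi_half)
  moreover have "phi m = cos b"
  proof -
    have "real m * b = pi / 2 - b" using Nb by (simp add: N algebra_simps)
    then show ?thesis by (simp add: phi_def cos_sin_eq)
  qed
  ultimately have "2 * (1 - cos b) * (\<Sum>i\<le>m. (h i)\<^sup>2) + (h N)\<^sup>2 * (1 - cos b)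
      \<le> (\<Sum>i<N. (h (Suc i) - h i)\<^sup>2)"
    using dirichlet_form_lower_bound[of N phi h "2 * (1 - cos b)" m, OF pos _ h0 eigen] by (simp add: N phi_def)
  moreover have "(1 - cos b) * (\<Sum>i\<le>m. (h i)\<^sup>2) \<ge> 0"
    by (intro mult_nonneg_nonneg sum_nonneg) auto
  ultimately show ?thesis unfolding b_def[symmetric] by (simp add: N algebra_simps)
qed

theorem proposition18:
  fixes W :: "real^'d::finite \<Rightarrow> real" and lam :: real and N :: nat
  assumes "smooth W"
    and "\<forall>x. W (- x) = W x"
    and "strongly_convex W lam"
    and "lam > 0"
    and "N \<ge> 1"
  shows "dirichlet_eigenvalue (N + 1) chain_adj lam \<ge> lam * (1 - cos (pi / (2 * real N)))"
  unfolding dirichlet_eigenvalue_def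
proof (rule cInf_greatest)
  \<comment> \<open>A lower bound passes to \<open>Inf\<close> only for a nonempty set; this witness
    vanishes at 0 because \<open>N \<ge> 1\<close>.\<close>
  have "unit_vec (N + 1) N \<in> carrier_vec (N + 1)" "unit_vec (N + 1) N $ 0 = (0::real)"
    using assms(5) by auto
  moreover have "unit_vec (N + 1) N \<noteq> (0\<^sub>v (N + 1) :: real vec)"
    by (simp add: unit_vec_nonzero)
  ultimately show "{- scalar_prod h (laplacian_mat (N + 1) chain_adj lam *\<^sub>v h) / scalar_prod h h | h.
      h \<in> carrier_vec (N + 1) \<and> h \<noteq> 0\<^sub>v (N + 1) \<and> h $ 0 = 0} \<noteq> {}"
    by blast
next
  fix r
  assume "r \<in> {- scalar_prod h (laplacian_mat (N + 1) chain_adj lam *\<^sub>v h) / scalar_prod h h | h.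
      h \<in> carrier_vec (N + 1) \<and> h \<noteq> 0\<^sub>v (N + 1) \<and> h $ 0 = 0}"
  then obtain h where r: "r = - scalar_prod h (laplacian_mat (N + 1) chain_adj lam *\<^sub>v h) / scalar_prod h h"
    and h: "h \<in> carrier_vec (Suc N)" and hnz: "h \<noteq> 0\<^sub>v (Suc N)" and h0: "h $ 0 = 0"
    by auto
  have hh: "scalar_prod h h = (\<Sum>i\<le>N. (h $ i)\<^sup>2)"
    using h by (simp add: scalar_prod_def power2_eq_square atLeast0LessThan lessThan_Suc_atMost)
  obtain i where i: "i < Suc N" "h $ i \<noteq> 0"
    using h hnz by (metis carrier_vecD eq_vecI index_zero_vec)
  have "scalar_prod h h > 0"
    unfolding hh using i by (intro sum_pos2[of _ i]) auto
  moreover have "lam * (1 - cos (pi / (2 * real N))) * scalar_prod h h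
      \<le> - scalar_prod h (laplacian_mat (N + 1) chain_adj lam *\<^sub>v h)"
    using chain_poincare[of N "($) h"] assms(4,5) h0 laplacian_mat_chain_quadratic_form[OF h, of lam]
    by (simp add: hh mult.assoc)
  ultimately show "lam * (1 - cos (pi / (2 * real N))) \<le> r"
    unfolding r by (simp only: pos_le_divide_eq Suc_eq_plus1)
qed

end
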